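(* Let $p,q$ be positive integers. The packing orbitope $\mathrm{O}^{\le}_{p,q}(\mathfrak{C}_q)$ for the cyclic group $\mathfrak{C}_q$ equals the set of all $x \in \mathbb{R}^{[p]\times[q]}$ that satisfy the following linear constraints: (a) the constraints $0 \le x_{11} \le 1$ and $x_{1j} = 0$ for all $2 \le j \le q$; (b) the nonnegativity constraints $x_{ij} \ge 0$ for all $2 \le i \le p$ and $j \in [q]$; (c) the row-sum inequalities $x(\mathrm{row}_i) \le 1$ for all $2 \le i \le p$; (d) the inequalities $\sum_{j=2}^q x_{ij} - \sum_{k=1}^{i-1} x_{k1} \le 0$ for all $2 \le i \le p$. This system of constraints is non-redundant.
   Context: Notation: $[n]=\{1,\dots,n\}$; $\mathrm{row}_i=\{(i,1),\dots,(i,q)\}$; $x(T)=\sum_{(i,j)\in T}x_{ij}$ for $T\subseteq[p]\times[q]$. $\mathfrak{C}_q$ is the cyclic group of all $q$ cyclic permutations of $[q]$, acting on $0/1$-matrices of size $p\times q$ by permuting columns. Let $\prec$ be the lexicographic order on $\{0,1\}^{[p]\times[q]}$ with respect to the row-wise ordering $(1,1)<(1,2)<\dots<(1,q)<(2,1)<\dots<(p,q)$ of positions, i.e. $A\prec B$ iff $a_{k\ell}<b_{k\ell}$ at the first position $(k,\ell)$ where $A=(a_{ij})$ and $B=(b_{ij})$ differ. The packing orbitope $\mathrm{O}^{\le}_{p,q}(\mathfrak{C}_q)$ is the convex hull in $\mathbb{R}^{[p]\times[q]}$ of all $0/1$-matrices of size $p\times q$ with at most one $1$-entry in each row that are $\prec$-maximal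 within their $\mathfrak{C}_q$-orbit. A system of constraints is non-redundant if dropping any of the constraints enlarges its solution set.
   Formalization: Non-redundancy is claimed only for p = 1 or q ≥ 2, since for q = 1, p ≥ 2 every inequality (d) follows from 0 ≤ x_11 and (b); the double inequality 0 ≤ x_11 ≤ 1 counts as a single constraint. *)

theory Defs
  imports "HOL-Analysis.Analysis" "HOL-Library.Function_Algebras" "HOL-Combinatorics.Cycles"
begin

(* Pointwise scaling turns the functions into a real vector space, so that the library's
   convex hull applies to matrices nat * nat => real with p and q arbitrary numbers. *)
instantiation "fun" :: (type, real_vector) real_vector
begin

definition scaleR_fun :: "real \<Rightarrow> ('a \<Rightarrow> 'b) \<Rightarrow> 'a \<Rightarrow> 'b"
  where "scaleR_fun r f = (\<lambda>x. r *\<^sub>R f x)"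

instance
  by standard (auto simp: scaleR_fun_def fun_eq_iff scaleR_add_right scaleR_add_left)

end

(* The space of real p x q matrices: entries outside the index set are fixed to 0, so that
   equality of functions is equality of matrices. *)
definition matrices :: "nat \<Rightarrow> nat \<Rightarrow> (nat \<times> nat \<Rightarrow> real) set"
  where "matrices p q = {x. \<forall>ij. ij \<notin> {1..p} \<times> {1..q} \<longrightarrow> x ij = 0}"

definition row :: "nat \<Rightarrow> nat \<Rightarrow> (nat \<times> nat) set"
  where "row q i = {i} \<times> {1..q}"

definition zero_one_matrices :: "nat \<Rightarrow> nat \<Rightarrow> (nat \<times> nat \<Rightarrow> real) set"
  where "zero_one_matrices p q = {A \<in> matrices p q. \<forall>ij. A ij \<in> {0, 1}}"

definition packing_matrices :: "nat \<Rightarrow> nat \<Rightarrow> (nat \<times> nat \<Rightarrow> real) set"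
  where "packing_matrices p q =
    {A \<in> zero_one_matrices p q. \<forall>i\<in>{1..p}. card {ij \<in> row q i. A ij = 1} \<le> 1}"

definition lex_less :: "nat \<Rightarrow> nat \<Rightarrow> (nat \<times> nat \<Rightarrow> real) \<Rightarrow> (nat \<times> nat \<Rightarrow> real) \<Rightarrow> bool"
  where "lex_less p q A B \<longleftrightarrow>
    (\<exists>k\<in>{1..p}. \<exists>l\<in>{1..q}. A (k, l) < B (k, l) \<and>
      (\<forall>i\<in>{1..p}. \<forall>j\<in>{1..q}. i < k \<or> i = k \<and> j < l \<longrightarrow> A (i, j) = B (i, j)))"

(* The powers of the q-cycle (1 2 ... q). *)
definition cyclic_perms :: "nat \<Rightarrow> (nat \<Rightarrow> nat) set"
  where "cyclic_perms q = range (\<lambda>s. cycle_of_list [1..<Suc q] ^^ s)"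

(* Left action: column j of A becomes column \<pi> j. *)
definition permute_columns :: "(nat \<Rightarrow> nat) \<Rightarrow> (nat \<times> nat \<Rightarrow> real) \<Rightarrow> nat \<times> nat \<Rightarrow> real"
  where "permute_columns \<pi> A = (\<lambda>(i, j). A (i, inv \<pi> j))"

definition column_orbit :: "(nat \<Rightarrow> nat) set \<Rightarrow> (nat \<times> nat \<Rightarrow> real) \<Rightarrow> (nat \<times> nat \<Rightarrow> real) set"
  where "column_orbit G A = (\<lambda>\<pi>. permute_columns \<pi> A) ` G"

definition packing_orbitope :: "nat \<Rightarrow> nat \<Rightarrow> (nat \<Rightarrow> nat) set \<Rightarrow> (nat \<times> nat \<Rightarrow> real) set"
  where "packing_orbitope p q G =
    convex hull {A \<in> packing_matrices p q. \<forall>B\<in>column_orbit G A. \<not> lex_less p q A B}"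

(* Constraints are indexed syntactically rather than identified with their solution sets, so that
   a constraint listed twice counts as two constraints of the system. The double inequality
   0 <= x_11 <= 1 is one constraint. *)
datatype orbitope_constraint =
    Bounds11
  | Zero nat
  | Nonneg nat nat
  | Row_Sum nat
  | First_Column nat

fun satisfies :: "nat \<Rightarrow> (nat \<times> nat \<Rightarrow> real) \<Rightarrow> orbitope_constraint \<Rightarrow> bool" where
  "satisfies q x Bounds11 \<longleftrightarrow> 0 \<le> x (1, 1) \<and> x (1, 1) \<le> 1"
| "satisfies q x (Zero j) \<longleftrightarrow> x (1, j) = 0"
| "satisfies q x (Nonneg i j) \<longleftrightarrow> x (i, j) \<ge> 0"
| "satisfies q x (Row_Sum i) \<longleftrightarrow> sum x (row q i) \<le> 1"
| "satisfies q x (First_Column i) \<longleftrightarrow> (\<Sum>j=2..q. x (i, j)) - (\<Sum>k=1..i-1. x (k, 1)) \<le> 0"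

definition orbitope_system :: "nat \<Rightarrow> nat \<Rightarrow> orbitope_constraint set"
  where "orbitope_system p q =
    {Bounds11} \<union> Zero ` {2..q}
    \<union> {Nonneg i j | i j. i \<in> {2..p} \<and> j \<in> {1..q}}
    \<union> Row_Sum ` {2..p}
    \<union> First_Column ` {2..p}"

definition solutions :: "nat \<Rightarrow> nat \<Rightarrow> orbitope_constraint set \<Rightarrow> (nat \<times> nat \<Rightarrow> real) set"
  where "solutions p q S = {x \<in> matrices p q. \<forall>c\<in>S. satisfies q x c}"

definition non_redundant :: "nat \<Rightarrow> nat \<Rightarrow> orbitope_constraint set \<Rightarrow> bool"
  where "non_redundant p q S \<longleftrightarrow> (\<forall>c\<in>S. solutions p q S \<subset> solutions p q (S - {c}))"

end

theory Submission
  imports Defs "HOL-Probability.Probability_Measure"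
begin

text \<open>A packing matrix is maximal in its orbit iff it is zero or its first nonzero row has its entry
  in column 1; these matrices satisfy the constraints. Conversely, a solution \<open>x\<close> is rounded at
  random: let \<open>S i = (\<Sum>k=1..i. x (k, 1))\<close>, and in row \<open>i\<close> lay out consecutive half-open intervals of
  lengths \<open>x (i, 1), ..., x (i, q)\<close> leftwards from \<open>S i\<close>. For \<open>u\<close> uniform in \<open>[0, 1)\<close> put a 1
  at \<open>(i, j)\<close> iff the \<open>j\<close>-th interval contains a point of \<open>u + \<int>\<close>. The row-sum inequality leaves at most
  one 1 per row. Column 1 stays empty before row \<open>i\<close> iff \<open>S (i - 1) \<le> u\<close>, and then inequality (d) keeps the
  intervals \<open>2, ..., q\<close> within \<open>[0, u)\<close>, so that they give no 1 either. The rounding is thus a vertex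
  with expectation \<open>x\<close>.\<close>

section \<open>Expectations as convex combinations\<close>

lemma sum_fun_apply: "sum f A k = (\<Sum>a\<in>A. f a k)"
  by (induction A rule: infinite_finite_induct) simp_all

text \<open>The mean of a finitely valued \<open>X\<close> is the average of its values, weighted by
  the probabilities of taking them. It is formed entry by entry, so that only real integrals
  occur.\<close>

lemma (in prob_space) expectation_in_convex_hull:
  fixes X :: "'a \<Rightarrow> 'k \<Rightarrow> real"
  assumes "finite V" and X: "\<And>\<omega>. \<omega> \<in> space M \<Longrightarrow> X \<omega> \<in> V"
    and meas: "\<And>v. v \<in> V \<Longrightarrow> {\<omega> \<in> space M. X \<omega> = v} \<in> events"
  shows "(\<lambda>k. expectation (\<lambda>\<omega>. X \<omega> k)) \<in> convex hull V"
proof -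
  define E where "E v = {\<omega> \<in> space M. X \<omega> = v}" for v
  have E: "E v \<in> events" if "v \<in> V" for v
    using meas[OF that] by (simp add: E_def)
  have "prob (\<Union>v\<in>V. E v) = (\<Sum>v\<in>V. prob (E v))"
    using E \<open>finite V\<close> by (intro finite_measure_finite_Union) (auto simp: disjoint_family_on_def E_def)
  moreover have "(\<Union>v\<in>V. E v) = space M"
    using X by (auto simp: E_def)
  ultimately have one: "(\<Sum>v\<in>V. prob (E v)) = 1"
    by (simp add: prob_space)
  have "expectation (\<lambda>\<omega>. X \<omega> k) = (\<Sum>v\<in>V. prob (E v) *\<^sub>R v) k" for k
  proof -
    have "expectation (\<lambda>\<omega>. X \<omega> k) = expectation (\<lambda>\<omega>. \<Sum>v\<in>V. v k * indicator (E v) \<omega>)"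
    proof (rule Bochner_Integration.integral_cong)
      fix \<omega> assume \<omega>: "\<omega> \<in> space M"
      have "(\<Sum>v\<in>V. v k * indicator (E v) \<omega>) = (\<Sum>v\<in>V. if v = X \<omega> then v k else 0)"
        using \<omega> by (intro sum.cong) (auto simp: E_def indicator_def)
      then show "X \<omega> k = (\<Sum>v\<in>V. v k * indicator (E v) \<omega>)"
        using X[OF \<omega>] \<open>finite V\<close> by simp
    qed simp
    also have "\<dots> = (\<Sum>v\<in>V. v k * prob (E v))"
      using E by (subst Bochner_Integration.integral_sum) (auto simp: emeasure_eq_measure)
    finally show ?thesis
      by (simp add: sum_fun_apply scaleR_fun_def mult.commute)
  qed
  then have "(\<lambda>k. expectation (\<lambda>\<omega>. X \<omega> k)) = (\<Sum>v\<in>V. prob (E v) *\<^sub>R v)"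
    by auto
  also have "\<dots> \<in> convex hull V"
    using \<open>finite V\<close> one by (intro convex_sum) (auto simp: hull_inc)
  finally show ?thesis .
qed

section \<open>Uniform distribution and the mean of a shifted ceiling\<close>

abbreviation unit_interval :: "real measure"
  where "unit_interval \<equiv> restrict_space lborel {0..<1}"

lemma prob_space_unit_interval: "prob_space unit_interval"
  by (rule prob_space_restrict_space) auto

text \<open>The integrand is \<open>\<lfloor>b\<rfloor> + 1\<close> for \<open>u < frac b\<close>
  and \<open>\<lfloor>b\<rfloor>\<close> from there on, so its mean is
  \<open>\<lfloor>b\<rfloor> + frac b\<close>. This is what makes the rounding unbiased.\<close>

lemma integral_ceiling_shift:
  fixes b :: real
  shows "integrable unit_interval (\<lambda>u. real_of_int \<lceil>b - u\<rceil>)" (is ?I)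
    and "(LINT u|unit_interval. real_of_int \<lceil>b - u\<rceil>) = b" (is ?E)
proof -
  interpret prob_space unit_interval by (rule prob_space_unit_interval)
  have eq: "real_of_int \<lceil>b - u\<rceil> = of_int \<lfloor>b\<rfloor> + indicator {0..<frac b} u"
    if "u \<in> space unit_interval" for u
  proof -
    have u: "0 \<le> u" "u < 1" using that by (auto simp: space_restrict_space)
    have b: "b = of_int \<lfloor>b\<rfloor> + frac b" by (simp add: frac_def)
    have f: "0 \<le> frac b" "frac b < 1" by (auto simp: frac_lt_1)
    show ?thesis
    proof (cases "u < frac b")
      case True
      then have "\<lceil>b - u\<rceil> = \<lfloor>b\<rfloor> + 1" using u b f by (intro ceiling_unique) linarith+
      then show ?thesis using True u by simp
    next
      case False
      then have "\<lceil>b - u\<rceil> = \<lfloor>b\<rfloor>" using u b f by (intro ceiling_unique) linarith+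
      then show ?thesis using False by simp
    qed
  qed
  have sub: "{0..<frac b} \<subseteq> {0..<1::real}" using frac_lt_1[of b] by auto
  have ev: "{0..<frac b} \<in> events" using sub by (auto simp: sets_restrict_space)
  have P: "prob {0..<frac b} = frac b"
    using sub by (simp add: measure_restrict_space min.absorb1 less_imp_le[OF frac_lt_1])
  have I: "integrable unit_interval (\<lambda>u. of_int \<lfloor>b\<rfloor> + indicator {0..<frac b} u :: real)"
    using ev by (auto simp: emeasure_eq_measure)
  then show ?I using eq by (subst Bochner_Integration.integrable_cong[OF refl]) auto
  have "(LINT u|unit_interval. real_of_int \<lceil>b - u\<rceil>)
      = (LINT u|unit_interval. of_int \<lfloor>b\<rfloor> + indicator {0..<frac b} u)"
    using eq by (intro Bochner_Integration.integral_cong) auto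
  also have "\<dots> = of_int \<lfloor>b\<rfloor> + frac b"
    using ev P prob_space by (subst Bochner_Integration.integral_add) (auto simp: emeasure_eq_measure min.absorb1 less_imp_le[OF frac_lt_1])
  finally show ?E by (simp add: frac_def)
qed

section \<open>Cyclic permutations of the columns\<close>

lemma cycle_upt_funpow:
  assumes "i < q"
  shows "(cycle_of_list [1..<Suc q] ^^ s) (Suc i) = Suc ((i + s) mod q)"
proof -
  have "map (cycle_of_list [1..<Suc q] ^^ s) [1..<Suc q] ! i = rotate s [1..<Suc q] ! i"
    by (subst cyclic_rotation) (auto simp del: upt_Suc)
  then show ?thesis
    using assms by (simp add: nth_rotate add.commute del: upt_Suc)
qed

lemma cyclic_perms_permutes:
  assumes "\<pi> \<in> cyclic_perms q"
  shows "\<pi> permutes {1..q}"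
proof -
  have "cycle_of_list [1..<Suc q] permutes {1..q}"
    using cycle_permutes[of "[1..<Suc q]"] by (simp add: atLeastLessThanSuc_atLeastAtMost del: upt_Suc)
  then show ?thesis
    using assms by (auto simp: cyclic_perms_def intro: permutes_funpow simp del: upt_Suc)
qed

text \<open>A rotation by \<open>s\<close> that fixes column 1 has \<open>s\<close> divisible by
  \<open>q\<close>. This freeness, together with transitivity, underlies the description of the
  maximal matrices.\<close>

lemma cyclic_perms_fix_one:
  assumes "\<pi> \<in> cyclic_perms q" and "\<pi> 1 = 1"
  shows "\<pi> = id"
proof
  fix j
  obtain s where s: "\<pi> = cycle_of_list [1..<Suc q] ^^ s"
    using assms by (auto simp: cyclic_perms_def)
  show "\<pi> j = id j"
  proof (cases "j \<in> {1..q}")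
    case True
    then obtain i where i: "j = Suc i" "i < q" by (cases j) auto
    have "Suc (s mod q) = 1"
      using assms(2) cycle_upt_funpow[of 0 q s] i s by simp
    then have "(i + s) mod q = i"
      using i by (metis One_nat_def Suc_inject add.right_neutral mod_add_right_eq mod_less)
    then show ?thesis using cycle_upt_funpow[OF i(2), of s] i s by simp
  next
    case False
    then show ?thesis using cyclic_perms_permutes[OF assms(1)] by (simp add: permutes_not_in)
  qed
qed

lemma cyclic_perms_transitive:
  assumes "c \<in> {1..q}"
  obtains \<pi> where "\<pi> \<in> cyclic_perms q" and "\<pi> c = 1"
proof -
  obtain i where i: "c = Suc i" "i < q" using assms by (cases c) auto
  have "(cycle_of_list [1..<Suc q] ^^ (q - i)) c = 1"
    using cycle_upt_funpow[OF i(2), of "q - i"] i by simp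
  then show ?thesis using that by (auto simp: cyclic_perms_def)
qed

section \<open>Packing matrices\<close>

lemma sum_row: "sum x (row q i) = (\<Sum>j=1..q. x (i, j))"
proof -
  have "row q i = Pair i ` {1..q}" by (auto simp: row_def)
  then show ?thesis by (simp add: sum.reindex inj_on_def)
qed

lemma sum_row_zero_one:
  assumes "A \<in> zero_one_matrices p q"
  shows "sum A (row q i) = real (card {ij \<in> row q i. A ij = 1})"
proof -
  have "sum A (row q i) = (\<Sum>ij\<in>row q i. if A ij = 1 then 1 else 0)"
    using assms by (intro sum.cong) (auto simp: zero_one_matrices_def)
  also have "\<dots> = real (card {ij \<in> row q i. A ij = 1})"
    by (subst sum.inter_filter[symmetric]) (auto simp: row_def)
  finally show ?thesis .
qed

text \<open>For 0/1 entries the number of ones in a row is the row sum, which turns the packing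
  condition into a linear one.\<close>

lemma packing_matrices_iff:
  "A \<in> packing_matrices p q \<longleftrightarrow>
    A \<in> zero_one_matrices p q \<and> (\<forall>i\<in>{1..p}. sum A (row q i) \<le> 1)"
  by (auto simp: packing_matrices_def sum_row_zero_one)

lemma packing_matrices_entry:
  assumes "A \<in> packing_matrices p q"
  shows "A ij \<in> {0, 1}" and "ij \<notin> {1..p} \<times> {1..q} \<Longrightarrow> A ij = 0"
proof -
  have A: "A \<in> matrices p q" "\<forall>ij. A ij \<in> {0, 1}"
    using assms unfolding packing_matrices_def zero_one_matrices_def by blast+
  show "A ij \<in> {0, 1}" by (rule spec[OF A(2)])
  show "A ij = 0" if "ij \<notin> {1..p} \<times> {1..q}"
    using A(1) that unfolding matrices_def by blast
qed

lemma finite_zero_one_matrices: "finite (zero_one_matrices p q)"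
proof (rule finite_subset)
  show "zero_one_matrices p q \<subseteq> indicator ` Pow ({1..p} \<times> {1..q})"
  proof
    fix A assume A: "A \<in> zero_one_matrices p q"
    then have "A = indicator {ij. A ij = 1}"
      by (force simp: zero_one_matrices_def fun_eq_iff indicator_def)
    moreover have "A ij = 0" if "ij \<notin> {1..p} \<times> {1..q}" for ij
      using A that unfolding zero_one_matrices_def matrices_def by blast
    then have "{ij. A ij = 1} \<subseteq> {1..p} \<times> {1..q}"
      unfolding subset_iff mem_Collect_eq by (metis zero_neq_one)
    ultimately show "A \<in> indicator ` Pow ({1..p} \<times> {1..q})" by blast
  qed
qed simp

lemma packing_matrices_unique:
  assumes "A \<in> packing_matrices p q" and "A (i, j) = 1" and "A (i, j') = 1"
  shows "j = j'"
proof -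
  have mem: "(i, j) \<in> {1..p} \<times> {1..q}" "(i, j') \<in> {1..p} \<times> {1..q}"
    using assms packing_matrices_entry(2)[OF assms(1)] by (metis zero_neq_one)+
  then have "card {ij \<in> row q i. A ij = 1} \<le> Suc 0"
    using assms(1) by (auto simp: packing_matrices_def)
  moreover have "finite {ij \<in> row q i. A ij = 1}" by (simp add: row_def)
  ultimately show ?thesis
    using assms(2,3) mem by (force simp: card_le_Suc0_iff_eq row_def)
qed

section \<open>Maximal matrices in their orbits\<close>

text \<open>For packing matrices this says that the matrix is zero or has the 1 of its first nonzero
  row in column 1. The entrywise form mirrors inequality (d): a 1 outside column 1 is paid for by a
  1 of column 1 in an earlier row.\<close>

definition starts_in_first_column :: "nat \<Rightarrow> (nat \<times> nat \<Rightarrow> real) \<Rightarrow> bool"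
  where "starts_in_first_column q A \<longleftrightarrow>
    (\<forall>i. \<forall>j\<in>{2..q}. A (i, j) = 1 \<longrightarrow> (\<exists>k\<in>{1..<i}. A (k, 1) = 1))"

text \<open>Otherwise the first nonzero row \<open>k\<close> has its 1 in a column
  \<open>c \<noteq> 1\<close>. Rotating \<open>c\<close> to column 1 keeps the rows above zero and
  raises the entry at \<open>(k, 1)\<close>, which gives a larger matrix.\<close>

lemma lex_maximal_imp_starts_in_first_column:
  assumes A: "A \<in> packing_matrices p q"
    and max: "\<forall>B\<in>column_orbit (cyclic_perms q) A. \<not> lex_less p q A B"
  shows "starts_in_first_column q A"
proof (rule ccontr)
  assume "\<not> ?thesis"
  then obtain i j where ij: "j \<in> {2..q}" "A (i, j) = 1" "\<And>k. k \<in> {1..<i} \<Longrightarrow> A (k, 1) \<noteq> 1"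
    by (auto simp: starts_in_first_column_def)
  note A01 = packing_matrices_entry(1)[OF A] and A_out = packing_matrices_entry(2)[OF A]
  define k where "k = (LEAST k. \<exists>c. A (k, c) = 1)"
  have "\<exists>c. A (k, c) = 1"
    unfolding k_def by (rule LeastI[where P = "\<lambda>k. \<exists>c. A (k, c) = 1"]) (use ij in blast)
  then obtain c where c: "A (k, c) = 1" by blast
  have kc: "k \<in> {1..p}" "c \<in> {1..q}"
    using A_out[of "(k, c)"] c by auto
  have before: "A (l, d) = 0" if "l < k" for l d
    using not_less_Least[OF that[unfolded k_def]] A01[of "(l, d)"] by auto
  have "k \<le> i"
    unfolding k_def by (rule Least_le) (use ij in blast)
  \<comment> \<open>A 1 at \<open>(k, 1)\<close> with \<open>k < i\<close> contradicts the choice of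
    \<open>i\<close>; with \<open>k = i\<close> it would be a second 1 in row \<open>i\<close>, next
    to the one in column \<open>j \<ge> 2\<close>.\<close>
  have "c \<noteq> 1"
  proof
    assume "c = 1"
    then have "k = i" using ij(3)[of k] c kc \<open>k \<le> i\<close> by fastforce
    then show False
      using packing_matrices_unique[OF A, of i j 1] ij c \<open>c = 1\<close> by auto
  qed
  then have Ak1: "A (k, 1) = 0"
    using packing_matrices_unique[OF A c, of 1] A01[of "(k, 1)"] by auto
  obtain \<pi> where \<pi>: "\<pi> \<in> cyclic_perms q" "\<pi> c = 1"
    using cyclic_perms_transitive kc by blast
  have inv: "inv \<pi> 1 = c"
    using \<pi> permutes_inverses(2)[OF cyclic_perms_permutes[OF \<pi>(1)], of c] by simp
  have "lex_less p q A (permute_columns \<pi> A)"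
    unfolding lex_less_def
  proof (intro bexI conjI ballI impI)
    show "A (k, 1) < permute_columns \<pi> A (k, 1)"
      using Ak1 c inv by (simp add: permute_columns_def)
    show "1 \<in> {1..q}" using kc by auto
    fix i' j' assume "j' \<in> {1..q}" "i' < k \<or> i' = k \<and> j' < 1"
    then show "A (i', j') = permute_columns \<pi> A (i', j')"
      by (auto simp: permute_columns_def before)
  qed (rule kc)
  then show False using max \<pi> by (auto simp: column_orbit_def)
qed

text \<open>Let \<open>B\<close> be larger, with first difference at \<open>(k, l)\<close>. As
  \<open>A\<close> and \<open>B\<close> agree above row \<open>k\<close> but never share a 1 in
  column 1, column 1 of \<open>A\<close> is empty there. So the 1 of \<open>A\<close> in row
  \<open>k\<close> that moves to column \<open>l\<close> lies in column 1. Then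
  \<open>l \<noteq> 1\<close>, and agreement at \<open>(k, 1)\<close> yields a shared 1 after
  all.\<close>

lemma starts_in_first_column_imp_lex_maximal:
  assumes A: "A \<in> packing_matrices p q" and start: "starts_in_first_column q A"
    and B: "B \<in> column_orbit (cyclic_perms q) A"
  shows "\<not> lex_less p q A B"
proof
  assume "lex_less p q A B"
  then obtain k l where kl: "k \<in> {1..p}" "l \<in> {1..q}" "A (k, l) < B (k, l)"
    and before: "\<And>i j. i \<in> {1..p} \<Longrightarrow> j \<in> {1..q} \<Longrightarrow> i < k \<or> i = k \<and> j < l \<Longrightarrow> A (i, j) = B (i, j)"
    unfolding lex_less_def by blast
  note A01 = packing_matrices_entry(1)[OF A] and A_out = packing_matrices_entry(2)[OF A]
  obtain \<pi> where \<pi>: "\<pi> \<in> cyclic_perms q" "B = permute_columns \<pi> A"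
    using B by (auto simp: column_orbit_def)
  have B_eq: "B (i, j) = A (i, inv \<pi> j)" for i j
    using \<pi> by (simp add: permute_columns_def)
  have perm: "\<pi> permutes {1..q}" by (rule cyclic_perms_permutes[OF \<pi>(1)])
  \<comment> \<open>A shared 1 would force \<open>\<pi>\<close> to fix column 1, since each row has
    only one 1; then \<open>\<pi> = id\<close> and \<open>B = A\<close>.\<close>
  have no_fix: "\<not> (A (i, 1) = 1 \<and> B (i, 1) = 1)" for i
  proof
    assume "A (i, 1) = 1 \<and> B (i, 1) = 1"
    then have "inv \<pi> 1 = 1"
      using packing_matrices_unique[OF A, of i 1 "inv \<pi> 1"] B_eq by auto
    then have "\<pi> 1 = 1"
      using permutes_inverses(1)[OF perm, of 1] by simp
    then have "\<pi> = id" by (rule cyclic_perms_fix_one[OF \<pi>(1)])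
    then show False using kl(3) B_eq by simp
  qed
  have q: "1 \<in> {1..q}" using kl by auto
  have no_one: "A (i, 1) \<noteq> 1" if "i < k" for i
    using no_fix[of i] before[of i 1] A_out[of "(i, 1)"] q that by force
  have "A (k, inv \<pi> l) = 1"
    using kl(3) A01[of "(k, l)"] A01[of "(k, inv \<pi> l)"] B_eq by auto
  moreover have "inv \<pi> l \<in> {1..q}"
    using permutes_in_image[OF permutes_inv[OF perm]] kl by blast
  ultimately have "inv \<pi> l = 1"
    using start no_one unfolding starts_in_first_column_def
    by (metis atLeastAtMost_iff atLeastLessThan_iff le_less Suc_1 Suc_leI One_nat_def)
  then have Ak1: "A (k, 1) = 1" using \<open>A (k, inv \<pi> l) = 1\<close> by simp
  then have "l \<noteq> 1" using kl(3) B_eq A01[of "(k, inv \<pi> l)"] by auto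
  then have "A (k, 1) = B (k, 1)" using before[of k 1] kl by auto
  then show False using no_fix[of k] Ak1 by simp
qed

lemma packing_orbitope_cyclic_perms:
  "packing_orbitope p q (cyclic_perms q) =
    convex hull {A \<in> packing_matrices p q. starts_in_first_column q A}"
proof -
  have "{A \<in> packing_matrices p q. \<forall>B\<in>column_orbit (cyclic_perms q) A. \<not> lex_less p q A B}
      = {A \<in> packing_matrices p q. starts_in_first_column q A}"
    using lex_maximal_imp_starts_in_first_column starts_in_first_column_imp_lex_maximal
    by (intro Collect_cong conj_cong refl) metis
  then show ?thesis by (simp only: packing_orbitope_def)
qed

section \<open>Validity of the constraints\<close>

lemma convex_solutions: "convex (solutions p q S)"
proof (rule convexI)
  fix x y :: "nat \<times> nat \<Rightarrow> real" and u v :: real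
  assume xy: "x \<in> solutions p q S" "y \<in> solutions p q S" and uv: "0 \<le> u" "0 \<le> v" "u + v = 1"
  have "satisfies q (u *\<^sub>R x + v *\<^sub>R y) c" if "satisfies q x c" "satisfies q y c" for c
  proof (cases c)
    case Bounds11
    then show ?thesis using that uv convex_bound_le[of "x (1,1)" 1 "y (1,1)" u v] by (simp add: scaleR_fun_def)
  next
    case (Zero j)
    then show ?thesis using that by (simp add: scaleR_fun_def)
  next
    case (Nonneg i j)
    then show ?thesis using that uv by (simp add: scaleR_fun_def)
  next
    case (Row_Sum i)
    then show ?thesis using that uv convex_bound_le[of "sum x (row q i)" 1 "sum y (row q i)" u v]
      by (simp add: scaleR_fun_def sum.distrib flip: sum_distrib_left)
  next
    case (First_Column i)
    let ?d = "\<lambda>x. (\<Sum>j=2..q. x (i, j)) - (\<Sum>k=1..i-1. x (k, 1))"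
    have "?d (u *\<^sub>R x + v *\<^sub>R y) = u * ?d x + v * ?d y"
      by (simp add: scaleR_fun_def sum.distrib algebra_simps flip: sum_distrib_left)
    moreover have "u * ?d x + v * ?d y \<le> 0"
      using First_Column that uv convex_bound_le[of "?d x" 0 "?d y" u v] by simp
    ultimately show ?thesis using First_Column by simp
  qed
  then show "u *\<^sub>R x + v *\<^sub>R y \<in> solutions p q S"
    using xy by (auto simp: solutions_def matrices_def scaleR_fun_def)
qed

text \<open>Row 1 has no predecessor, so it vanishes outside column 1. For (d), the part of row
  \<open>i\<close> outside column 1 sums to at most 1, and if it contains a 1, some
  \<open>A (k, 1) = 1\<close> with \<open>k < i\<close> makes up for it.\<close>

lemma vertex_in_solutions:
  assumes A: "A \<in> packing_matrices p q" and start: "starts_in_first_column q A"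
  shows "A \<in> solutions p q (orbitope_system p q)"
proof -
  note A01 = packing_matrices_entry(1)[OF A]
  have nonneg: "0 \<le> A ij" and le1: "A ij \<le> 1" for ij
    using A01[of ij] by auto
  have row: "(\<Sum>j=1..q. A (i, j)) \<le> 1" if "i \<in> {1..p}" for i
    using A that by (auto simp: packing_matrices_iff sum_row)
  have zero: "A (1, j) = 0" if "j \<in> {2..q}" for j
    using start that A01[of "(1, j)"] unfolding starts_in_first_column_def by fastforce
  have col: "(\<Sum>j=2..q. A (i, j)) \<le> (\<Sum>k=1..i-1. A (k, 1))" if "i \<in> {2..p}" for i
  proof (cases "\<exists>j\<in>{2..q}. A (i, j) = 1")
    case True
    then obtain k where k: "k \<in> {1..<i}" "A (k, 1) = 1"
      using start by (auto simp: starts_in_first_column_def)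
    have "(\<Sum>j=2..q. A (i, j)) \<le> (\<Sum>j=1..q. A (i, j))"
      by (rule sum_mono2) (auto simp: nonneg)
    also have "\<dots> \<le> A (k, 1)" using row that k by auto
    also have "\<dots> \<le> (\<Sum>k=1..i-1. A (k, 1))"
      using k by (intro member_le_sum[where f = "\<lambda>k. A (k, 1)"]) (auto simp: nonneg)
    finally show ?thesis .
  next
    case False
    then have "(\<Sum>j=2..q. A (i, j)) = 0"
      using A01 by (intro sum.neutral) blast
    then show ?thesis by (simp add: sum_nonneg nonneg)
  qed
  have "satisfies q A c" if "c \<in> orbitope_system p q" for c
    using that col row zero nonneg le1 by (auto simp: orbitope_system_def sum_row)
  then show ?thesis
    using A by (auto simp: solutions_def packing_matrices_def zero_one_matrices_def)
qed

section \<open>Rounding a solution\<close>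

context
  fixes p q :: nat and x :: "nat \<times> nat \<Rightarrow> real"
  assumes x: "x \<in> solutions p q (orbitope_system p q)" and q_pos: "q \<ge> 1"
begin

lemma solution_satisfies: "c \<in> orbitope_system p q \<Longrightarrow> satisfies q x c"
  using x by (simp add: solutions_def)

lemma solution_nonneg: "x (i, j) \<ge> 0"
proof (cases "(i, j) \<in> {1..p} \<times> {1..q}")
  case True
  then consider "i = 1" "j = 1" | "i = 1" "j \<in> {2..q}" | "i \<in> {2..p}" "j \<in> {1..q}"
    by fastforce
  then show ?thesis
  proof cases
    case 1
    then show ?thesis using solution_satisfies[of Bounds11] by (simp add: orbitope_system_def)
  next
    case 2
    then show ?thesis using solution_satisfies[of "Zero j"] by (simp add: orbitope_system_def)
  next
    case 3
    then show ?thesis using solution_satisfies[of "Nonneg i j"] by (simp add: orbitope_system_def)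
  qed
next
  case False
  then show ?thesis using x by (simp add: solutions_def matrices_def)
qed

lemma solution_first_row: "(\<Sum>j=2..q. x (1, j)) = 0"
proof (intro sum.neutral ballI)
  show "x (1, j) = 0" if "j \<in> {2..q}" for j
    using that solution_satisfies[of "Zero j"] by (simp add: orbitope_system_def)
qed

text \<open>In row 1, governed by (a), both sides of (d) vanish. Thus the rounding can treat all
  rows alike.\<close>

lemma solution_tail_le: 
  assumes "i \<in> {1..p}"
  shows "(\<Sum>j=2..q. x (i, j)) \<le> (\<Sum>k=1..i-1. x (k, 1))"
proof (cases "i = 1")
  case True
  then show ?thesis using solution_first_row by simp
next
  case False
  then show ?thesis
    using assms solution_satisfies[of "First_Column i"] by (simp add: orbitope_system_def)
qed

lemma sum_split_first: "(\<Sum>j=1..q. f j) = f 1 + (\<Sum>j=2..q. f j :: real)"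
  using q_pos by (simp add: sum.atLeast_Suc_atMost numeral_2_eq_2)

lemma solution_row_le:
  assumes "i \<in> {1..p}"
  shows "(\<Sum>j=1..q. x (i, j)) \<le> 1"
proof (cases "i = 1")
  case True
  then show ?thesis
    using solution_first_row solution_satisfies[of Bounds11]
    by (subst sum_split_first) (simp add: orbitope_system_def)
next
  case False
  then show ?thesis
    using assms solution_satisfies[of "Row_Sum i"] by (simp add: orbitope_system_def sum_row)
qed

text \<open>The \<open>j\<close>-th interval of row \<open>i\<close> is the half-open range from
  \<open>endpoint i j\<close> to \<open>endpoint i (j - 1)\<close>; the layout begins on the right
  at \<open>endpoint i 0\<close>, which is \<open>S i\<close>.\<close>

definition endpoint :: "nat \<Rightarrow> nat \<Rightarrow> real"
  where "endpoint i j = (\<Sum>k=1..i. x (k, 1)) - (\<Sum>l=1..j. x (i, l))"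

text \<open>The difference of ceilings counts the integers \<open>m\<close> with
  \<open>endpoint i j \<le> u + m < endpoint i (j - 1)\<close>.\<close>

definition rounding :: "real \<Rightarrow> nat \<times> nat \<Rightarrow> real"
  where "rounding u = (\<lambda>(i, j). if (i, j) \<in> {1..p} \<times> {1..q}
    then of_int (\<lceil>endpoint i (j - 1) - u\<rceil> - \<lceil>endpoint i j - u\<rceil>) else 0)"

lemma endpoint_diff: "j \<ge> 1 \<Longrightarrow> endpoint i (j - 1) - endpoint i j = x (i, j)"
  by (cases j) (simp_all add: endpoint_def)

text \<open>The first interval of row \<open>i\<close> spans the increment from
  \<open>S (i - 1)\<close> to \<open>S i\<close>. Hence the first intervals of consecutive rows are
  adjacent, and sums down column 1 telescope as sums along a row do.\<close>

lemma endpoint_one: "i \<ge> 1 \<Longrightarrow> endpoint i 1 = endpoint (i - 1) 0"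
  by (cases i) (simp_all add: endpoint_def)

lemma rounding_nonneg: "rounding u ij \<ge> 0"
proof (cases ij)
  case (Pair i j)
  have "endpoint i j \<le> endpoint i (j - 1)" if "j \<ge> 1"
    using endpoint_diff[OF that, of i] solution_nonneg[of i j] by linarith
  then show ?thesis by (auto simp: rounding_def Pair intro!: ceiling_mono)
qed

lemma rounding_partial_row:
  assumes "i \<in> {1..p}" and "m \<le> q"
  shows "(\<Sum>j=Suc m..q. rounding u (i, j)) = of_int (\<lceil>endpoint i m - u\<rceil> - \<lceil>endpoint i q - u\<rceil>)"
proof -
  define f where "f j = - real_of_int \<lceil>endpoint i j - u\<rceil>" for j
  have "(\<Sum>j=Suc m..q. rounding u (i, j)) = (\<Sum>j=Suc m..q. f j - f (j - 1))"
    using assms by (intro sum.cong) (auto simp: rounding_def f_def)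
  also have "\<dots> = f q - f m" using assms by (rule_tac sum_telescope'')
  finally show ?thesis by (simp add: f_def)
qed

lemma rounding_first_column:
  assumes "i \<le> p"
  shows "(\<Sum>k=1..i. rounding u (k, 1)) = of_int (\<lceil>endpoint i 0 - u\<rceil> - \<lceil>- u\<rceil>)"
proof -
  define f where "f k = real_of_int \<lceil>endpoint k 0 - u\<rceil>" for k
  have "(\<Sum>k=Suc 0..i. rounding u (k, 1)) = (\<Sum>k=Suc 0..i. f k - f (k - 1))"
    using assms q_pos endpoint_one by (intro sum.cong) (auto simp: rounding_def f_def)
  also have "\<dots> = f i - f 0" by (rule sum_telescope'') simp
  finally show ?thesis by (simp add: f_def endpoint_def)
qed

text \<open>The intervals of a row have total length at most 1, and a shift by at most 1 raises a
  ceiling by at most 1.\<close>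

lemma rounding_row_le:
  assumes "i \<in> {1..p}"
  shows "(\<Sum>j=1..q. rounding u (i, j)) \<le> 1"
proof -
  have "endpoint i 0 \<le> endpoint i q + 1"
    using solution_row_le[OF assms] by (simp add: endpoint_def)
  then have "\<lceil>endpoint i 0 - u\<rceil> \<le> \<lceil>endpoint i q - u\<rceil> + 1" by linarith
  then show ?thesis using rounding_partial_row[OF assms, of 0 u] by simp
qed

text \<open>Each entry is a nonnegative integer bounded by its row sum, hence 0 or 1.\<close>

lemma rounding_packing: "rounding u \<in> packing_matrices p q"
proof -
  have "rounding u ij \<in> {0, 1}" for ij
  proof (cases "ij \<in> {1..p} \<times> {1..q}")
    case True
    then obtain i j where ij: "ij = (i, j)" "i \<in> {1..p}" "j \<in> {1..q}" by auto
    obtain n :: int where n: "rounding u ij = of_int n"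
      using ij by (simp add: rounding_def del: of_int_diff)
    have "rounding u (i, j) \<le> (\<Sum>j=1..q. rounding u (i, j))"
      using ij by (intro member_le_sum[where f = "\<lambda>j. rounding u (i, j)"]) (auto simp: rounding_nonneg)
    also have "\<dots> \<le> 1" using ij by (intro rounding_row_le)
    finally have "n \<le> 1" using n ij by simp
    moreover have "n \<ge> 0" using rounding_nonneg[of u ij] n by simp
    ultimately have "n = 0 \<or> n = 1" by linarith
    then show ?thesis using n by auto
  qed (cases ij, auto simp: rounding_def)
  then show ?thesis
    using rounding_row_le
    by (auto simp: packing_matrices_iff zero_one_matrices_def matrices_def sum_row)
      (auto simp: rounding_def)
qed

lemma rounding_starts_in_first_column:
  assumes u: "0 \<le> u" "u < 1"
  shows "starts_in_first_column q (rounding u)"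
proof (rule ccontr)
  assume "\<not> ?thesis"
  then obtain i j where j: "j \<in> {2..q}" and one: "rounding u (i, j) = 1"
    and none: "\<And>k. k \<in> {1..<i} \<Longrightarrow> rounding u (k, 1) \<noteq> 1"
    by (auto simp: starts_in_first_column_def)
  have i: "i \<in> {1..p}" using one by (auto simp: rounding_def split: if_splits)
  have "rounding u (k, 1) = 0" if "k \<in> {1..i-1}" for k
    using none[of k] that rounding_packing[of u]
    by (fastforce simp: packing_matrices_def zero_one_matrices_def)
  then have "(\<Sum>k=1..i-1. rounding u (k, 1)) = 0" by simp
  \<comment> \<open>With this the empty column 1 above row \<open>i\<close> gives
    \<open>S (i - 1) \<le> u\<close>, expressed through the ceiling.\<close>
  moreover have "\<lceil>- u\<rceil> = 0" using u by linarith
  ultimately have "\<lceil>endpoint (i - 1) 0 - u\<rceil> = 0"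
    using rounding_first_column[of "i - 1" u] i by auto
  \<comment> \<open>This is inequality (d), since \<open>endpoint i q\<close> equals
    \<open>S (i - 1)\<close> minus the sum of row \<open>i\<close> outside column 1. As
    \<open>u < 1\<close>, the ceiling below cannot drop to -1.\<close>
  moreover have "endpoint i q \<ge> 0"
    using solution_tail_le[OF i] i sum_split_first[of "\<lambda>j. x (i, j)"] by (cases i) (simp_all add: endpoint_def)
  then have "\<lceil>endpoint i q - u\<rceil> \<ge> 0" using u by linarith
  ultimately have "(\<Sum>j=Suc 1..q. rounding u (i, j)) \<le> 0"
    using i q_pos by (subst rounding_partial_row) (auto simp: endpoint_one[simplified])
  moreover have "rounding u (i, j) \<le> (\<Sum>j=Suc 1..q. rounding u (i, j))"
    using j by (intro member_le_sum[where f = "\<lambda>j. rounding u (i, j)"]) (auto simp: rounding_nonneg)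
  ultimately show False using one by simp
qed

lemma expectation_rounding: "(LINT u|unit_interval. rounding u (i, j)) = x (i, j)"
proof (cases "(i, j) \<in> {1..p} \<times> {1..q}")
  case True
  then have "(LINT u|unit_interval. rounding u (i, j))
      = (LINT u|unit_interval. of_int \<lceil>endpoint i (j - 1) - u\<rceil> - of_int \<lceil>endpoint i j - u\<rceil>)"
    by (simp add: rounding_def)
  also have "\<dots> = endpoint i (j - 1) - endpoint i j"
    by (subst Bochner_Integration.integral_diff) (rule integral_ceiling_shift | simp add: integral_ceiling_shift)+
  also have "\<dots> = x (i, j)" using True by (intro endpoint_diff) auto
  finally show ?thesis .
next
  case False
  then show ?thesis using x by (auto simp: rounding_def solutions_def matrices_def)
qed

lemma solution_in_hull:
  "x \<in> convex hull {A \<in> packing_matrices p q. starts_in_first_column q A}"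
proof -
  interpret prob_space unit_interval by (rule prob_space_unit_interval)
  have "(\<lambda>ij. expectation (\<lambda>u. rounding u ij))
      \<in> convex hull {A \<in> packing_matrices p q. starts_in_first_column q A}"
  proof (rule expectation_in_convex_hull)
    show "finite {A \<in> packing_matrices p q. starts_in_first_column q A}"
      by (rule finite_subset[OF _ finite_zero_one_matrices]) (auto simp: packing_matrices_def)
    show "rounding u \<in> {A \<in> packing_matrices p q. starts_in_first_column q A}"
      if "u \<in> space unit_interval" for u
      using that rounding_packing rounding_starts_in_first_column by (auto simp: space_restrict_space)
    show "{u \<in> space unit_interval. rounding u = v} \<in> events"
      if "v \<in> {A \<in> packing_matrices p q. starts_in_first_column q A}" for v
    proof -
      \<comment> \<open>Equality with \<open>v\<close> is a condition on finitely many measurable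
        entries, because both matrices vanish off the index set.\<close>
      have "(\<lambda>u. rounding u ij) \<in> borel_measurable unit_interval" for ij
        by (cases ij) (auto simp: rounding_def intro!: measurable_restrict_space1)
      then have "{u \<in> space unit_interval. \<forall>ij\<in>{1..p} \<times> {1..q}. rounding u ij = v ij} \<in> events"
        by measurable
      moreover have "rounding u = v \<longleftrightarrow> (\<forall>ij\<in>{1..p} \<times> {1..q}. rounding u ij = v ij)" for u
        using that packing_matrices_entry(2)[OF rounding_packing] packing_matrices_entry(2)[of v]
        unfolding fun_eq_iff mem_Collect_eq by metis
      ultimately show ?thesis by simp
    qed
  qed
  moreover have "(\<lambda>ij. expectation (\<lambda>u. rounding u ij)) = x"
    by (simp add: fun_eq_iff expectation_rounding)
  ultimately show ?thesis by simp
qed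

end

section \<open>Non-redundancy\<close>

abbreviation unit_matrix :: "nat \<Rightarrow> nat \<Rightarrow> nat \<times> nat \<Rightarrow> real"
  where "unit_matrix a b \<equiv> indicator {(a, b)}"

lemma sum_row_unit_matrix:
  "sum (unit_matrix a b) (row q i) = (if i = a \<and> b \<in> {1..q} then 1 else 0)"
  by (cases "i = a") (auto simp: sum_row indicator_def)

lemma sum_tail_unit_matrix:
  "(\<Sum>j=2..q. unit_matrix a b (i, j)) = (if i = a \<and> b \<in> {2..q} then 1 else 0)"
  by (cases "i = a") (simp_all add: indicator_def)

lemma sum_column_unit_matrix:
  "(\<Sum>k=1..m. unit_matrix a b (k, c)) = (if b = c \<and> a \<in> {1..m} then 1 else 0)"
  by (cases "b = c") (simp_all add: indicator_def)

lemma satisfies_others: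
  assumes "Bounds11 \<noteq> c \<Longrightarrow> 0 \<le> w (1, 1) \<and> w (1, 1) \<le> 1"
    and "\<And>j. j \<in> {2..q} \<Longrightarrow> Zero j \<noteq> c \<Longrightarrow> w (1, j) = 0"
    and "\<And>i j. i \<in> {2..p} \<Longrightarrow> j \<in> {1..q} \<Longrightarrow> Nonneg i j \<noteq> c \<Longrightarrow> 0 \<le> w (i, j)"
    and "\<And>i. i \<in> {2..p} \<Longrightarrow> Row_Sum i \<noteq> c \<Longrightarrow> sum w (row q i) \<le> 1"
    and "\<And>i. i \<in> {2..p} \<Longrightarrow> First_Column i \<noteq> c \<Longrightarrow>
      (\<Sum>j=2..q. w (i, j)) \<le> (\<Sum>k=1..i-1. w (k, 1))"
  shows "\<forall>c' \<in> orbitope_system p q - {c}. satisfies q w c'"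
proof
  fix c' assume "c' \<in> orbitope_system p q - {c}"
  then have "c' \<in> orbitope_system p q" "c' \<noteq> c" by auto
  then show "satisfies q w c'"
    using assms by (cases c') (auto simp: orbitope_system_def)
qed

text \<open>For each constraint a witness violates it and satisfies all others. The case
  \<open>q = 1\<close>, \<open>p \<ge> 2\<close> is excluded: there the sum over \<open>j\<close> in
  (d) is empty, and (d) follows from nonnegativity of column 1.\<close>

lemma non_redundant_orbitope_system:
  assumes "p \<ge> 1" and "q \<ge> 1" and "p = 1 \<or> q \<ge> 2"
  shows "non_redundant p q (orbitope_system p q)"
proof -
  let ?S = "orbitope_system p q"
  note sums = sum_row_unit_matrix sum_tail_unit_matrix sum_column_unit_matrix
  have witness: "\<exists>w \<in> matrices p q. \<not> satisfies q w c \<and> (\<forall>c' \<in> ?S - {c}. satisfies q w c')"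
    if "c \<in> ?S" for c
  proof -
    consider "c = Bounds11" | j where "c = Zero j" "j \<in> {2..q}"
      | i j where "c = Nonneg i j" "i \<in> {2..p}" "j \<in> {1..q}"
      | i where "c = Row_Sum i" "i \<in> {2..p}" | i where "c = First_Column i" "i \<in> {2..p}"
      using \<open>c \<in> ?S\<close> unfolding orbitope_system_def by blast
    then show ?thesis
    proof cases
      case 1
      then show ?thesis using assms
        by (intro bexI[of _ "2 *\<^sub>R unit_matrix 1 1"] conjI satisfies_others)
          (auto simp: scaleR_fun_def matrices_def sums simp del: One_nat_def simp flip: sum_distrib_left)
    next
      case (2 j)
      then show ?thesis using assms
        by (intro bexI[of _ "unit_matrix 1 j"] conjI satisfies_others)
          (auto simp: matrices_def sums indicator_eq_0_iff simp del: One_nat_def)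
    next
      \<comment> \<open>The 1 at \<open>(1, 1)\<close> matters for \<open>j = 1\<close>: it keeps
        the partial sums of column 1 nonnegative, as (d) demands.\<close>
      case (3 i j)
      then show ?thesis using assms
        by (intro bexI[of _ "unit_matrix 1 1 - unit_matrix i j"] conjI satisfies_others)
          (auto simp: matrices_def sum_subtractf sum_negf sums simp del: One_nat_def)
    next
      \<comment> \<open>Row \<open>i\<close> sums to 2; the 1 at \<open>(1, 1)\<close> pays in (d)
        for the one at \<open>(i, 2)\<close>. Since \<open>i \<ge> 2\<close> forces
        \<open>p \<ge> 2\<close>, column 2 exists.\<close>
      case (4 i)
      then show ?thesis using assms
        by (intro bexI[of _ "unit_matrix 1 1 + unit_matrix i 1 + unit_matrix i 2"] conjI satisfies_others)
          (auto simp: matrices_def sum.distrib sums simp del: One_nat_def)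
    next
      case (5 i)
      then show ?thesis using assms
        by (intro bexI[of _ "unit_matrix i 2"] conjI satisfies_others)
          (auto simp: matrices_def sums simp del: One_nat_def)
    qed
  qed
  show ?thesis
    unfolding non_redundant_def
  proof
    fix c assume "c \<in> ?S"
    with witness obtain w where "w \<in> solutions p q (?S - {c})" "w \<notin> solutions p q ?S"
      unfolding solutions_def by blast
    moreover have "solutions p q ?S \<subseteq> solutions p q (?S - {c})"
      by (auto simp: solutions_def)
    ultimately show "solutions p q ?S \<subset> solutions p q (?S - {c})" by blast
  qed
qed

theorem theorem4:
  fixes p q :: nat
  assumes "p \<ge> 1" and "q \<ge> 1"
  shows "packing_orbitope p q (cyclic_perms q) = solutions p q (orbitope_system p q)
    \<and> (p = 1 \<or> q \<ge> 2 \<longrightarrow> non_redundant p q (orbitope_system p q))"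
proof -
  have "convex hull {A \<in> packing_matrices p q. starts_in_first_column q A}
      \<subseteq> solutions p q (orbitope_system p q)"
    using vertex_in_solutions by (intro hull_minimal convex_solutions) blast
  then show ?thesis
    using solution_in_hull assms non_redundant_orbitope_system
    by (auto simp: packing_orbitope_cyclic_perms)
qed

end
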